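(* If $G$ is a finite simple graph containing no induced subgraph isomorphic to $P_3\cup 2K_1$ and no induced subgraph isomorphic to $\overline{P_3\cup 2K_1}$, and $\omega(G)=3$, then $\chi(G)\leq 7$.
   Context: $P_3\cup 2K_1$ denotes the disjoint union of a path on three vertices and two isolated vertices; $\overline{H}$ is the complement of $H$. $\omega(G)$ is the clique number and $\chi(G)$ the chromatic number. *)

theory Defs
  imports "Graph_Theory.Graph_Theory"
begin

text \<open>
  A finite simple graph is a \<^locale>\<open>graph\<close>: a finite symmetric digraph without loops and
  parallel arcs, each undirected edge being a pair of opposite arcs.
\<close>

definition has_induced_copy :: "('a, 'b) pre_digraph \<Rightarrow> ('c, 'd) pre_digraph \<Rightarrow> bool" where
  "has_induced_copy G H \<longleftrightarrow> (\<exists>K. induced_subgraph K G \<and> digraph_iso K H)"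

definition graph_complement :: "'a pair_pre_digraph \<Rightarrow> 'a pair_pre_digraph" where
  "graph_complement H =
    \<lparr> pverts = pverts H,
      parcs = {(u, v). u \<in> pverts H \<and> v \<in> pverts H \<and> u \<noteq> v \<and> (u, v) \<notin> parcs H} \<rparr>"

text \<open>The path is 0 - 1 - 2; the vertices 3 and 4 are isolated.\<close>

definition P3_2K1 :: "nat pair_pre_digraph" where
  "P3_2K1 = \<lparr> pverts = {0, 1, 2, 3, 4}, parcs = {(0, 1), (1, 0), (1, 2), (2, 1)} \<rparr>"

definition is_clique :: "('a, 'b) pre_digraph \<Rightarrow> 'a set \<Rightarrow> bool" where
  "is_clique G S \<longleftrightarrow> S \<subseteq> verts G \<and> pairwise (\<lambda>u v. u \<rightarrow>\<^bsub>G\<^esub> v) S"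

definition clique_number :: "('a, 'b) pre_digraph \<Rightarrow> nat" where
  "clique_number G = Max {card S | S. is_clique G S}"

definition is_coloring :: "('a, 'b) pre_digraph \<Rightarrow> nat \<Rightarrow> ('a \<Rightarrow> nat) \<Rightarrow> bool" where
  "is_coloring G k c \<longleftrightarrow>
    (\<forall>v \<in> verts G. c v < k) \<and> (\<forall>u v. u \<rightarrow>\<^bsub>G\<^esub> v \<longrightarrow> c u \<noteq> c v)"

definition chromatic_number :: "('a, 'b) pre_digraph \<Rightarrow> nat" where
  "chromatic_number G = (LEAST k. \<exists>c. is_coloring G k c)"

end

theory Submission
  imports Defs
begin

text \<open>
  Fix a vertex \<open>v\<close>. Its neighbourhood is triangle-free, and triangle-free \<open>P3 + 2K1\<close>-free graphs are
  3-colourable. Its non-neighbourhood is \<open>P3 + K1\<close>-free and \<open>K4\<close>-free; such graphs are 4-colourable,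
  and \<open>v\<close> may reuse one of these colours, so seven colours suffice.

  A \<open>P3 + K1\<close>-free graph with an independent triple is the join of a disjoint union of cliques with
  the set of vertices complete to the triple. A \<open>K4\<close>-free graph of minimum degree at least four
  without an independent triple has at most nine vertices; nine are excluded by double counting,
  and otherwise disjoint non-edges serve as colour classes.
\<close>

section \<open>Bounding cardinalities by excluding distinct elements\<close>

lemma card_le_2I:
  assumes "finite X" "\<And>x y z. \<lbrakk>x \<in> X; y \<in> X; z \<in> X; x \<noteq> y; x \<noteq> z; y \<noteq> z\<rbrakk> \<Longrightarrow> False"
  shows "card X \<le> 2"
proof (rule ccontr)
  assume "\<not> card X \<le> 2"
  then have "3 \<le> card X" by simp
  then obtain S where "S \<subseteq> X" "card S = 3"
    by (meson obtain_subset_with_card_n)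
  then show False using assms(2) unfolding card_3_iff by blast
qed

lemma card_le_3I:
  assumes "finite X"
    "\<And>w x y z. \<lbrakk>{w, x, y, z} \<subseteq> X; distinct [w, x, y, z]\<rbrakk> \<Longrightarrow> False"
  shows "card X \<le> 3"
proof (rule ccontr)
  assume "\<not> card X \<le> 3"
  then have "4 \<le> card X" by simp
  then obtain S where S: "S \<subseteq> X" "card S = 4"
    by (meson obtain_subset_with_card_n)
  then have "card S = Suc 3" by simp
  then obtain w S' where w: "S = insert w S'" "w \<notin> S'" "card S' = 3"
    unfolding card_Suc_eq by blast
  then obtain x y z where "S' = {x, y, z}" "x \<noteq> y" "y \<noteq> z" "x \<noteq> z"
    unfolding card_3_iff by blast
  then show False using assms(2)[of w x y z] w S by auto
qed

section \<open>Simple graphs as adjacency relations\<close>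

text \<open>Only the adjacency relation is fixed; the notions below take a vertex set as argument,
  so an induced subgraph is just a subset. The locale can also be interpreted for the complement
  relation.\<close>

locale simple_graph =
  fixes adj :: "'a \<Rightarrow> 'a \<Rightarrow> bool" (infix \<open>\<sim>\<close> 50)
  assumes adj_sym: "x \<sim> y \<Longrightarrow> y \<sim> x"
    and adj_irrefl: "\<not> x \<sim> x"
begin

lemma adj_commute: "x \<sim> y \<longleftrightarrow> y \<sim> x"
  by (blast intro: adj_sym)

definition nbrs :: "'a set \<Rightarrow> 'a \<Rightarrow> 'a set" where
  "nbrs V v = {w \<in> V. v \<sim> w}"

definition nonnbrs :: "'a set \<Rightarrow> 'a \<Rightarrow> 'a set" where
  "nonnbrs V v = {w \<in> V. w \<noteq> v \<and> \<not> v \<sim> w}"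

definition independent :: "'a set \<Rightarrow> bool" where
  "independent S \<longleftrightarrow> (\<forall>x\<in>S. \<forall>y\<in>S. \<not> x \<sim> y)"

definition colorable :: "nat \<Rightarrow> 'a set \<Rightarrow> bool" where
  "colorable k V \<longleftrightarrow> (\<exists>c :: 'a \<Rightarrow> nat. (\<forall>v\<in>V. c v < k) \<and> (\<forall>u\<in>V. \<forall>v\<in>V. u \<sim> v \<longrightarrow> c u \<noteq> c v))"

definition triangle_free :: "'a set \<Rightarrow> bool" where
  "triangle_free V \<longleftrightarrow> (\<forall>x\<in>V. \<forall>y\<in>V. \<forall>z\<in>V. \<not> (x \<sim> y \<and> x \<sim> z \<and> y \<sim> z))"

text \<open>Phrased through neighbourhoods because results on triangle-free graphs get applied to
  \<open>nbrs V v\<close>.\<close>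

definition K4_free :: "'a set \<Rightarrow> bool" where
  "K4_free V \<longleftrightarrow> (\<forall>w\<in>V. triangle_free (nbrs V w))"

definition no_indep_triple :: "'a set \<Rightarrow> bool" where
  "no_indep_triple V \<longleftrightarrow> (\<forall>x\<in>V. \<forall>y\<in>V. \<forall>z\<in>V.
    x \<noteq> y \<longrightarrow> x \<noteq> z \<longrightarrow> y \<noteq> z \<longrightarrow> x \<sim> y \<or> x \<sim> z \<or> y \<sim> z)"

text \<open>These are the disjoint unions of cliques.\<close>

definition P3_free :: "'a set \<Rightarrow> bool" where
  "P3_free V \<longleftrightarrow> (\<forall>x\<in>V. \<forall>y\<in>V. \<forall>z\<in>V. x \<noteq> z \<longrightarrow> x \<sim> y \<longrightarrow> y \<sim> z \<longrightarrow> x \<sim> z)"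

text \<open>An isolated vertex is peeled off by passing to its non-neighbourhood;
  \<open>P3_2K1_free\<close> adds a second such layer, so the hypothesis passes directly to
  \<open>nonnbrs V v\<close>.\<close>

definition P3_K1_free :: "'a set \<Rightarrow> bool" where
  "P3_K1_free V \<longleftrightarrow> (\<forall>v\<in>V. P3_free (nonnbrs V v))"

definition P3_2K1_free :: "'a set \<Rightarrow> bool" where
  "P3_2K1_free V \<longleftrightarrow> (\<forall>v\<in>V. P3_K1_free (nonnbrs V v))"

lemma nbrs_subset: "nbrs V v \<subseteq> V"
  and nonnbrs_subset: "nonnbrs V v \<subseteq> V"
  by (auto simp: nbrs_def nonnbrs_def)

lemma nonnbrs_mono: "U \<subseteq> V \<Longrightarrow> nonnbrs U v \<subseteq> nonnbrs V v"
  by (auto simp: nonnbrs_def)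

lemma finite_nbrs: "finite V \<Longrightarrow> finite (nbrs V v)"
  and finite_nonnbrs: "finite V \<Longrightarrow> finite (nonnbrs V v)"
  by (auto simp: nbrs_def nonnbrs_def)

lemma triangle_free_mono: "triangle_free V \<Longrightarrow> U \<subseteq> V \<Longrightarrow> triangle_free U"
  unfolding triangle_free_def by blast

lemma K4_free_mono: "K4_free V \<Longrightarrow> U \<subseteq> V \<Longrightarrow> K4_free U"
  unfolding K4_free_def triangle_free_def nbrs_def by blast

lemma no_indep_triple_mono: "no_indep_triple V \<Longrightarrow> U \<subseteq> V \<Longrightarrow> no_indep_triple U"
  unfolding no_indep_triple_def by blast

lemma P3_free_mono: "P3_free V \<Longrightarrow> U \<subseteq> V \<Longrightarrow> P3_free U"
  unfolding P3_free_def by blast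

lemma P3_K1_free_mono: "P3_K1_free V \<Longrightarrow> U \<subseteq> V \<Longrightarrow> P3_K1_free U"
  unfolding P3_K1_free_def by (meson P3_free_mono in_mono nonnbrs_mono)

lemma P3_2K1_free_mono: "P3_2K1_free V \<Longrightarrow> U \<subseteq> V \<Longrightarrow> P3_2K1_free U"
  unfolding P3_2K1_free_def by (meson P3_K1_free_mono in_mono nonnbrs_mono)

lemma card_split:
  assumes "finite V" "v \<in> V"
  shows "card V = 1 + card (nbrs V v) + card (nonnbrs V v)"
proof -
  have "V = insert v (nbrs V v \<union> nonnbrs V v)"
    using assms by (auto simp: nbrs_def nonnbrs_def)
  moreover have "v \<notin> nbrs V v \<union> nonnbrs V v"
    by (auto simp: nbrs_def nonnbrs_def adj_irrefl)
  moreover have "card (nbrs V v \<union> nonnbrs V v) = card (nbrs V v) + card (nonnbrs V v)"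
    using assms by (intro card_Un_disjoint) (auto simp: nbrs_def nonnbrs_def)
  ultimately show ?thesis
    using assms by (metis add.assoc card_insert_disjoint finite_nbrs finite_nonnbrs finite_UnI plus_1_eq_Suc)
qed

section \<open>Tools for colouring\<close>

lemma colorable_mono: "colorable k V \<Longrightarrow> U \<subseteq> V \<Longrightarrow> k \<le> l \<Longrightarrow> colorable l U"
  unfolding colorable_def by (meson order_less_le_trans subsetD)

lemma colorable_Un:
  assumes "colorable k A" "colorable l B"
  shows "colorable (k + l) (A \<union> B)"
proof -
  obtain c d where c: "\<forall>v\<in>A. c v < k" "\<forall>u\<in>A. \<forall>v\<in>A. u \<sim> v \<longrightarrow> c u \<noteq> c v"
    and d: "\<forall>v\<in>B. d v < l" "\<forall>u\<in>B. \<forall>v\<in>B. u \<sim> v \<longrightarrow> d u \<noteq> d v"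
    using assms unfolding colorable_def by blast
  let ?e = "\<lambda>v. if v \<in> A then c v else k + d v"
  have "\<forall>v\<in>A \<union> B. ?e v < k + l" using c d by (auto simp: trans_less_add1)
  moreover have "\<forall>u\<in>A \<union> B. \<forall>v\<in>A \<union> B. u \<sim> v \<longrightarrow> ?e u \<noteq> ?e v"
  proof (intro ballI impI)
    fix u v assume "u \<in> A \<union> B" "v \<in> A \<union> B" "u \<sim> v"
    then show "?e u \<noteq> ?e v"
      using c d by (smt (verit, best) Un_iff add_left_imp_eq le_add1 leD)
  qed
  ultimately show ?thesis unfolding colorable_def by (intro exI[of _ ?e]) simp
qed

lemma colorable_empty: "colorable k {}"
  by (auto simp: colorable_def)

lemma colorable_independent: "independent S \<Longrightarrow> colorable 1 S"
  unfolding independent_def colorable_def by (intro exI[of _ "\<lambda>_. 0"]) auto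

lemma independent_pair: "\<not> x \<sim> y \<Longrightarrow> independent {x, y}"
  using adj_irrefl adj_commute by (auto simp: independent_def)

lemma colorable_Suc:
  assumes "colorable k A" "independent S" "V \<subseteq> A \<union> S"
  shows "colorable (Suc k) V"
  using colorable_mono[OF colorable_Un[OF assms(1) colorable_independent[OF assms(2)]] assms(3)] by simp

text \<open>The neighbours of \<open>v\<close> occupy fewer than \<open>k\<close> colours, which
  leaves one for \<open>v\<close>.\<close>

lemma colorable_greedy:
  assumes "finite V" "colorable k (V - {v})" "card (nbrs V v) < k"
  shows "colorable k V"
proof -
  obtain c where c: "\<forall>x\<in>V - {v}. c x < k" "\<forall>x\<in>V - {v}. \<forall>y\<in>V - {v}. x \<sim> y \<longrightarrow> c x \<noteq> c y"
    using assms(2) unfolding colorable_def by blast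
  have "card (c ` nbrs V v) < card {..<k}"
    using card_image_le[OF finite_nbrs[OF assms(1)], of c v] assms(3) by simp
  then have "\<not> {..<k} \<subseteq> c ` nbrs V v"
    by (meson assms(1) card_mono finite_imageI finite_nbrs leD)
  then obtain i where i: "i < k" "i \<notin> c ` nbrs V v" by auto
  let ?c = "c(v := i)"
  have "\<forall>x\<in>V. ?c x < k" using c i by auto
  moreover have "?c x \<noteq> ?c y" if "x \<in> V" "y \<in> V" "x \<sim> y" for x y
    using that i c(2) adj_irrefl adj_commute by (auto simp: nbrs_def image_iff)
  ultimately show ?thesis unfolding colorable_def by blast
qed

text \<open>This is how \<open>v\<close> reuses a colour: it has no neighbour in this set.\<close>

lemma colorable_insert_nonnbrs:
  assumes "colorable k (nonnbrs V v)" "finite V" "0 < k"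
  shows "colorable k (insert v (nonnbrs V v))"
proof (rule colorable_greedy[where v = v])
  show "finite (insert v (nonnbrs V v))" using assms by (simp add: finite_nonnbrs)
  show "colorable k (insert v (nonnbrs V v) - {v})"
    using assms(1) by (rule colorable_mono) auto
  have "nbrs (insert v (nonnbrs V v)) v = {}"
    by (auto simp: nbrs_def nonnbrs_def adj_irrefl)
  then show "card (nbrs (insert v (nonnbrs V v)) v) < k" using assms by simp
qed

lemma vertices_split: "V \<subseteq> insert v (nonnbrs V v) \<union> nbrs V v"
  by (auto simp: nbrs_def nonnbrs_def)

lemma independent_nbrs: "triangle_free V \<Longrightarrow> v \<in> V \<Longrightarrow> independent (nbrs V v)"
  by (auto simp: triangle_free_def independent_def nbrs_def)

text \<open>Degeneracy argument: delete a vertex of degree below \<open>k\<close>, colour the rest,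
  and put the vertex back. \<open>Q\<close> is any property that survives deletion and provides such
  a vertex.\<close>

lemma colorable_greedy_induct:
  assumes "finite V" "Q V" "\<And>U. finite U \<Longrightarrow> Q U \<Longrightarrow> U \<noteq> {} \<Longrightarrow> \<exists>v\<in>U. card (nbrs U v) < k"
    "\<And>U v. Q U \<Longrightarrow> Q (U - {v})"
  shows "colorable k V"
  using assms(1,2)
proof (induction "card V" arbitrary: V)
  case 0
  then show ?case by (simp add: colorable_empty)
next
  case (Suc n)
  then obtain v where v: "v \<in> V" "card (nbrs V v) < k" using assms(3)[of V] by fastforce
  have "colorable k (V - {v})"
    by (rule Suc.hyps(1)) (use Suc v assms(4) in auto)
  then show ?case using colorable_greedy Suc.prems v by blast
qed

section \<open>Disjoint unions of cliques\<close>

text \<open>Two neighbours of a vertex are adjacent and would close a triangle, so all degrees are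
  at most one.\<close>

lemma colorable_P3_free_triangle_free:
  assumes "finite V" "P3_free V" "triangle_free V"
  shows "colorable 2 V"
proof (rule colorable_greedy_induct[where Q = "\<lambda>V. P3_free V \<and> triangle_free V"])
  fix U assume U: "finite U" "P3_free U \<and> triangle_free U" "U \<noteq> {}"
  then obtain v where v: "v \<in> U" by auto
  have "card (nbrs U v) \<le> 1"
  proof -
    have "x = y" if "x \<in> nbrs U v" "y \<in> nbrs U v" for x y
      using that U v adj_commute unfolding P3_free_def triangle_free_def nbrs_def by blast
    then show ?thesis using card_le_Suc0_iff_eq[OF finite_nbrs[OF U(1)], of v] by auto
  qed
  then have "card (nbrs U v) < 2" by simp
  then show "\<exists>v\<in>U. card (nbrs U v) < 2" using v by blast
qed (use assms in \<open>auto intro: P3_free_mono triangle_free_mono\<close>)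

text \<open>Three neighbours of a vertex are pairwise adjacent and would complete a K4, so all
  degrees are at most two.\<close>

lemma colorable_P3_free_K4_free:
  assumes "finite V" "P3_free V" "K4_free V"
  shows "colorable 3 V"
proof (rule colorable_greedy_induct[where Q = "\<lambda>V. P3_free V \<and> K4_free V"])
  fix U assume U: "finite U" "P3_free U \<and> K4_free U" "U \<noteq> {}"
  then obtain v where v: "v \<in> U" by auto
  have "card (nbrs U v) \<le> 2"
  proof (rule card_le_2I)
    fix x y z assume "x \<in> nbrs U v" "y \<in> nbrs U v" "z \<in> nbrs U v" "x \<noteq> y" "x \<noteq> z" "y \<noteq> z"
    moreover from this have "x \<sim> y" "x \<sim> z" "y \<sim> z"
      using U v adj_commute unfolding P3_free_def nbrs_def by blast+
    ultimately show False using U v unfolding K4_free_def triangle_free_def by blast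
  qed (use U finite_nbrs in auto)
  then have "card (nbrs U v) < 3" by simp
  then show "\<exists>v\<in>U. card (nbrs U v) < 3" using v by blast
qed (use assms in \<open>auto intro: P3_free_mono K4_free_mono\<close>)

section \<open>Triangle-free graphs that are small or have no independent triple\<close>

lemma card_nbrs_le_2:
  assumes "finite V" "triangle_free V" "no_indep_triple V" "v \<in> V"
  shows "card (nbrs V v) \<le> 2"
proof (rule card_le_2I)
  fix x y z assume "x \<in> nbrs V v" "y \<in> nbrs V v" "z \<in> nbrs V v" "x \<noteq> y" "x \<noteq> z" "y \<noteq> z"
  then show False
    using assms unfolding triangle_free_def no_indep_triple_def nbrs_def by blast
qed (use assms finite_nbrs in auto)

text \<open>Two non-adjacent non-neighbours of \<open>v\<close> would form an independent triple
  with \<open>v\<close>.\<close>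

lemma nonnbrs_adj:
  assumes "no_indep_triple V" "v \<in> V" "x \<in> nonnbrs V v" "y \<in> nonnbrs V v" "x \<noteq> y"
  shows "x \<sim> y"
proof -
  from assms(3,4) have "x \<in> V" "y \<in> V" "x \<noteq> v" "y \<noteq> v" "\<not> v \<sim> x" "\<not> v \<sim> y"
    by (auto simp: nonnbrs_def)
  with assms(1,2,5) show ?thesis unfolding no_indep_triple_def by metis
qed

lemma card_nonnbrs_le_2:
  assumes "finite V" "triangle_free V" "no_indep_triple V" "v \<in> V"
  shows "card (nonnbrs V v) \<le> 2"
proof (rule card_le_2I)
  fix x y z assume *: "x \<in> nonnbrs V v" "y \<in> nonnbrs V v" "z \<in> nonnbrs V v" "x \<noteq> y" "x \<noteq> z" "y \<noteq> z"
  then have "x \<sim> y" "x \<sim> z" "y \<sim> z" using nonnbrs_adj[OF assms(3,4)] by auto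
  then show False using * assms(2) nonnbrs_subset unfolding triangle_free_def by blast
qed (use assms finite_nonnbrs in auto)

text \<open>The Ramsey bound R(3,3) \<le> 6, obtained as 1 + 2 + 2 around any vertex.\<close>

lemma card_le_5:
  assumes "finite V" "triangle_free V" "no_indep_triple V"
  shows "card V \<le> 5"
proof (cases "V = {}")
  case False
  then obtain v where "v \<in> V" by auto
  then show ?thesis
    using card_split[of V v] card_nbrs_le_2[of V v] card_nonnbrs_le_2[of V v] assms by linarith
qed auto

lemma colorable_triangle_free_no_indep_triple:
  assumes "finite V" "triangle_free V" "no_indep_triple V"
  shows "colorable 3 V"
proof (rule colorable_greedy_induct[where Q = "\<lambda>V. triangle_free V \<and> no_indep_triple V"])
  fix U assume "finite U" "triangle_free U \<and> no_indep_triple U" "U \<noteq> {}"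
  then show "\<exists>v\<in>U. card (nbrs U v) < 3" using card_nbrs_le_2 by fastforce
qed (use assms in \<open>auto intro: triangle_free_mono no_indep_triple_mono\<close>)

text \<open>A vertex of degree at most one is coloured greedily. A vertex of larger degree has at
  most one non-neighbour; the two share a colour, and the independent neighbourhood takes the
  other.\<close>

lemma colorable_triangle_free_card_le_4:
  assumes "finite V" "triangle_free V" "card V \<le> 4"
  shows "colorable 2 V"
  using assms
proof (induction "card V" arbitrary: V)
  case 0
  then show ?case by (simp add: colorable_empty)
next
  case (Suc n)
  then obtain v where v: "v \<in> V" by fastforce
  show ?case
  proof (cases "card (nbrs V v) < 2")
    case True
    have "colorable 2 (V - {v})"
      by (rule Suc.hyps(1)) (use Suc v in \<open>auto intro: triangle_free_mono\<close>)
    then show ?thesis using colorable_greedy Suc.prems True by blast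
  next
    case False
    then have "card (nonnbrs V v) \<le> 1"
      using card_split[OF Suc.prems(1) v] Suc.prems by linarith
    then have "independent (nonnbrs V v)"
      using card_le_Suc0_iff_eq[OF finite_nonnbrs[OF Suc.prems(1)], of v] adj_irrefl
      by (auto simp: independent_def)
    then have "colorable 1 (insert v (nonnbrs V v))"
      by (intro colorable_insert_nonnbrs colorable_independent Suc.prems) auto
    from colorable_Suc[OF this independent_nbrs[OF Suc.prems(2) v] vertices_split]
    show ?thesis by (simp add: numeral_2_eq_2)
  qed
qed

section \<open>Structure of P3 + K1-free graphs with an independent triple\<close>

text \<open>Explicit form for four vertices: otherwise \<open>a\<close>, \<open>b\<close>,
  \<open>c\<close> is an induced path and \<open>d\<close> is isolated from it.\<close>

lemma P3_K1_freeD: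
  assumes "P3_K1_free V" "{a, b, c, d} \<subseteq> V" "a \<sim> b" "b \<sim> c" "a \<noteq> c"
    "d \<noteq> a" "d \<noteq> b" "d \<noteq> c" "\<not> d \<sim> a" "\<not> d \<sim> b" "\<not> d \<sim> c"
  shows "a \<sim> c"
proof -
  have "P3_free (nonnbrs V d)" using assms unfolding P3_K1_free_def by blast
  moreover have "a \<in> nonnbrs V d" "b \<in> nonnbrs V d" "c \<in> nonnbrs V d"
    using assms unfolding nonnbrs_def by auto
  ultimately show ?thesis using assms(3-5) unfolding P3_free_def by blast
qed

text \<open>
  The set \<open>A\<close> consists of the vertices complete to a fixed independent triple; every other vertex
  has at most one neighbour in the triple.
\<close>
lemma P3_K1_free_decomposition:
  assumes P: "P3_K1_free V" and "\<not> no_indep_triple V"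
  obtains A U where "V = A \<union> U" "U \<noteq> {}" "P3_free U" "\<And>a u. a \<in> A \<Longrightarrow> u \<in> U \<Longrightarrow> a \<sim> u"
proof -
  obtain a b c where abc: "a \<in> V" "b \<in> V" "c \<in> V" "a \<noteq> b" "a \<noteq> c" "b \<noteq> c"
    "\<not> a \<sim> b" "\<not> a \<sim> c" "\<not> b \<sim> c"
    using assms(2) unfolding no_indep_triple_def by blast
  let ?T = "{a, b, c}"
  define A where "A = {x \<in> V. \<forall>t\<in>?T. x \<sim> t}"
  define U where "U = V - A"
  have triple: "\<not> s \<sim> t" if "s \<in> ?T" "t \<in> ?T" for s t
    using that abc adj_commute adj_irrefl by auto
  have unique: "s = t" if "x \<in> U" "s \<in> ?T" "t \<in> ?T" "x \<sim> s" "x \<sim> t" for x s t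
  proof (rule ccontr)
    assume "s \<noteq> t"
    \<comment> \<open>The path \<open>s\<close>, \<open>x\<close>, \<open>t\<close> together with
      the missed vertex \<open>r\<close> would be an induced P3 + K1.\<close>
    obtain r where r: "r \<in> ?T" "\<not> x \<sim> r" using \<open>x \<in> U\<close> unfolding U_def A_def by blast
    have "x \<noteq> r" using that r triple by auto
    then have "s \<sim> t"
      using P3_K1_freeD[OF P, of s x t r] that r \<open>s \<noteq> t\<close> abc triple adj_commute
      unfolding U_def by auto
    then show False using triple that by auto
  qed
  have pair: "\<not> (x \<sim> a \<and> x \<sim> b)" "\<not> (x \<sim> a \<and> x \<sim> c)" "\<not> (x \<sim> b \<and> x \<sim> c)" if "x \<in> U" for x
    using unique[OF that, of a b] unique[OF that, of a c] unique[OF that, of b c] abc by auto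
  have third: "\<exists>r\<in>?T. r \<noteq> s \<and> r \<noteq> t" for s t using abc by auto
  have "P3_free U"
    unfolding P3_free_def
  proof (intro ballI impI, rule ccontr)
    fix x y z assume xyz: "x \<in> U" "y \<in> U" "z \<in> U" "x \<noteq> z" "x \<sim> y" "y \<sim> z" "\<not> x \<sim> z"
    have V: "x \<in> V" "y \<in> V" "z \<in> V" using xyz U_def by auto
    \<comment> \<open>A triple vertex off the path and without a neighbour on it would complete an
      induced P3 + K1.\<close>
    have hit: "t = x \<or> t = y \<or> t = z \<or> x \<sim> t \<or> y \<sim> t \<or> z \<sim> t" if "t \<in> ?T" for t
      using P3_K1_freeD[OF P, of x y z t] xyz V that abc adj_commute by auto
    \<comment> \<open>If \<open>y\<close> were in the triple, it would be the only triple neighbour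
      of \<open>x\<close> and of \<open>z\<close>, so the other two triple vertices would violate
      \<open>hit\<close>.\<close>
    have not_y: "y \<notin> ?T"
    proof
      assume y: "y \<in> ?T"
      obtain s where s: "s \<in> ?T" "s \<noteq> y" using third by metis
      have "\<not> x \<sim> s" "\<not> z \<sim> s"
        using unique[of x y s] unique[of z y s] y s xyz adj_commute by blast+
      moreover have "\<not> y \<sim> s" "s \<noteq> x" "s \<noteq> z"
        using triple y s xyz adj_commute by blast+
      ultimately show False using hit s by blast
    qed
    \<comment> \<open>If an end \<open>p\<close> is in the triple, it is the only triple neighbour
      of \<open>y\<close>; by \<open>hit\<close> the other end \<open>q\<close> is then adjacent to
      both remaining triple vertices, against \<open>unique\<close>.\<close>
    have not_end: False if p: "p \<in> ?T" "q \<in> U" "p \<noteq> q" "{p, q} = {x, z}" for p q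
    proof -
      have "p \<sim> y" "q \<sim> y" using p xyz adj_commute by (auto simp: doubleton_eq_iff)
      have q: "q \<sim> s" if s: "s \<in> ?T" "s \<noteq> p" for s
      proof -
        have "\<not> y \<sim> s" using unique[of y p s] xyz s p \<open>p \<sim> y\<close> adj_commute by blast
        moreover from this have "s \<noteq> q" using \<open>q \<sim> y\<close> adj_commute by blast
        moreover have "s \<noteq> y" "\<not> p \<sim> s" using not_y s triple p by auto
        ultimately show ?thesis using hit[OF s(1)] s(2) p(4) by (auto simp: doubleton_eq_iff)
      qed
      obtain s where s: "s \<in> ?T" "s \<noteq> p" using third by metis
      obtain t where t: "t \<in> ?T" "t \<noteq> p" "t \<noteq> s" using third by metis
      show False using unique[OF p(2) s(1) t(1) q q] s t by blast
    qed
    have "x \<notin> ?T" "z \<notin> ?T"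
      using not_end[of x z] not_end[of z x] xyz by blast+
    then have hits: "x \<sim> t \<or> y \<sim> t \<or> z \<sim> t" if "t \<in> ?T" for t
      using hit[OF that] not_y that by auto
    \<comment> \<open>Three triple vertices are hit by three path vertices, each hitting at most
      one, so the hits are a matching of \<open>x\<close>, \<open>y\<close>, \<open>z\<close> with
      \<open>s\<close>, \<open>t\<close>, \<open>r\<close>. Then \<open>s\<close>, \<open>x\<close>,
      \<open>y\<close> is an induced path and \<open>r\<close> is isolated from it.\<close>
    have "x \<sim> a \<or> x \<sim> b \<or> x \<sim> c"
      using hits[of a] hits[of b] hits[of c] pair[OF xyz(2)] pair[OF xyz(3)] by auto
    then obtain s where s: "s \<in> ?T" "x \<sim> s" by auto
    have "y \<sim> a \<or> y \<sim> b \<or> y \<sim> c"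
      using hits[of a] hits[of b] hits[of c] pair[OF xyz(1)] pair[OF xyz(3)] by auto
    then obtain t where t: "t \<in> ?T" "y \<sim> t" by auto
    obtain r where r: "r \<in> ?T" "r \<noteq> s" "r \<noteq> t" using third by metis
    have "\<not> x \<sim> r" "\<not> y \<sim> r"
      using unique[OF xyz(1) s(1) r(1)] unique[OF xyz(2) t(1) r(1)] s t r by auto
    then have "z \<sim> r" using hits r by blast
    have "s \<noteq> t"
    proof
      assume "s = t"
      obtain q where q: "q \<in> ?T" "q \<noteq> r" "q \<noteq> t" using third by metis
      then have "\<not> x \<sim> q" "\<not> y \<sim> q" "\<not> z \<sim> q"
        using unique[OF xyz(1) s(1) q(1)] unique[OF xyz(2) t(1) q(1)] unique[OF xyz(3) r(1) q(1)]
          s t \<open>z \<sim> r\<close> \<open>s = t\<close> by auto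
      then show False using hits[OF q(1)] by blast
    qed
    then have "\<not> s \<sim> y" using unique[OF xyz(2) s(1) t(1)] t adj_commute by blast
    moreover have "s \<sim> x" "r \<noteq> x" "r \<noteq> y" "s \<noteq> y" "\<not> r \<sim> x" "\<not> r \<sim> y" "\<not> r \<sim> s"
      using s r \<open>\<not> x \<sim> r\<close> \<open>\<not> y \<sim> r\<close> \<open>x \<notin> ?T\<close> not_y triple[of r s] adj_sym by blast+
    moreover have "{s, x, y, r} \<subseteq> V" using s r abc V by auto
    ultimately show False
      using P3_K1_freeD[OF P, of s x y r] r(2) xyz(5) by blast
  qed
  moreover have "x \<sim> u" if "x \<in> A" "u \<in> U" for x u
  proof (rule ccontr)
    assume "\<not> x \<sim> u"
    then have "u \<notin> ?T" using that adj_commute unfolding A_def by blast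
    \<comment> \<open>Since \<open>u\<close> misses two triple vertices \<open>s\<close> and
      \<open>t\<close>, the induced path \<open>s\<close>, \<open>x\<close>, \<open>t\<close> would
      have \<open>u\<close> isolated from it.\<close>
    have "\<exists>s\<in>?T. \<exists>t\<in>?T. s \<noteq> t \<and> \<not> u \<sim> s \<and> \<not> u \<sim> t"
      using pair[OF that(2)] abc by auto
    then obtain s t where st: "s \<in> ?T" "t \<in> ?T" "s \<noteq> t" "\<not> u \<sim> s" "\<not> u \<sim> t" by blast
    have mem: "{s, x, t, u} \<subseteq> V" using st abc that unfolding A_def U_def by auto
    have "s \<sim> x" "x \<sim> t" "u \<noteq> x" "u \<noteq> s" "u \<noteq> t" "\<not> u \<sim> x"
      using st that \<open>u \<notin> ?T\<close> \<open>\<not> x \<sim> u\<close> adj_sym unfolding A_def U_def by blast+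
    then show False
      using P3_K1_freeD[OF P mem] st triple[of s t] by blast
  qed
  moreover have "a \<in> U" using abc adj_irrefl unfolding U_def A_def by auto
  ultimately show ?thesis
    using that[of A U] unfolding U_def A_def by blast
qed

section \<open>Three-colouring triangle-free P3 + 2K1-free graphs\<close>

text \<open>If \<open>A\<close> is nonempty, an edge on one side of the join and a vertex on the
  other would form a triangle, so both sides are independent.\<close>

lemma colorable_triangle_free_indep_triple:
  assumes "finite V" "triangle_free V" "P3_K1_free V" "\<not> no_indep_triple V"
  shows "colorable 2 V"
proof -
  obtain A U where AU: "V = A \<union> U" "U \<noteq> {}" "P3_free U" "\<And>a u. a \<in> A \<Longrightarrow> u \<in> U \<Longrightarrow> a \<sim> u"
    using P3_K1_free_decomposition[OF assms(3,4)] by metis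
  show ?thesis
  proof (cases "A = {}")
    case True
    then show ?thesis using colorable_P3_free_triangle_free assms AU by auto
  next
    case False
    then have "independent U"
      using AU assms(2) unfolding independent_def triangle_free_def by blast
    moreover have "independent A"
      using AU assms(2) unfolding independent_def triangle_free_def by blast
    ultimately show ?thesis
      using colorable_Suc[OF colorable_independent, of A U V] AU by (auto simp: numeral_2_eq_2)
  qed
qed

lemma colorable_triangle_free_P3_K1_free:
  assumes "finite V" "triangle_free V" "P3_K1_free V"
  shows "colorable 3 V"
proof (cases "no_indep_triple V")
  case True
  then show ?thesis using colorable_triangle_free_no_indep_triple assms by blast
next
  case False
  then show ?thesis
    using colorable_mono[OF colorable_triangle_free_indep_triple[OF assms]] by simp
qed

text \<open>
  Every vertex of the non-neighbourhood \<open>Q\<close> of \<open>v\<close> has degree 2 in \<open>Q\<close>, so counting the edges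
  between \<open>Q\<close> and the neighbourhood of \<open>v\<close> from both sides gives \<open>5 = 6\<close>.
\<close>
lemma no_cubic_nine:
  assumes "finite V" "triangle_free V" "\<And>x. x \<in> V \<Longrightarrow> card (nbrs V x) = 3" "v \<in> V"
    and "card (nonnbrs V v) = 5" "no_indep_triple (nonnbrs V v)"
  shows False
proof -
  define N where "N = nbrs V v"
  define Q where "Q = nonnbrs V v"
  have fin: "finite N" "finite Q" using assms(1) finite_nbrs finite_nonnbrs unfolding N_def Q_def by auto
  have Q3: "triangle_free Q" "no_indep_triple Q" "card Q = 5"
    using assms triangle_free_mono nonnbrs_subset unfolding Q_def by blast+
  have "card {w \<in> N. w \<sim> q} = 1" if q: "q \<in> Q" for q
  proof -
    \<comment> \<open>In 5 = 1 + 2 + 2 both upper bounds must be attained.\<close>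
    have "card (nbrs Q q) = 2"
      using card_split[OF fin(2) q] card_nbrs_le_2[OF fin(2) Q3(1,2) q]
        card_nonnbrs_le_2[OF fin(2) Q3(1,2) q] Q3(3) by linarith
    moreover have "nbrs V q = {w \<in> N. w \<sim> q} \<union> nbrs Q q"
      using q adj_commute unfolding nbrs_def N_def Q_def nonnbrs_def by auto
    moreover have "{w \<in> N. w \<sim> q} \<inter> nbrs Q q = {}"
      unfolding nbrs_def N_def Q_def nonnbrs_def by auto
    moreover have "card (nbrs V q) = 3" using q assms(3) nonnbrs_subset unfolding Q_def by auto
    ultimately show ?thesis
      using card_Un_disjoint[of "{w \<in> N. w \<sim> q}" "nbrs Q q"] fin finite_nbrs by auto
  qed
  then have "(\<Sum>w\<in>N. card {q \<in> Q. w \<sim> q}) = 1 * card Q"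
    by (intro sum_multicount fin) auto
  moreover have "card {q \<in> Q. w \<sim> q} = 2" if w: "w \<in> N" for w
  proof -
    \<comment> \<open>A neighbour of \<open>w\<close> inside \<open>N\<close> would form a triangle
      with \<open>v\<close>.\<close>
    have "nbrs V w = insert v {q \<in> Q. w \<sim> q}"
      using w assms(2,4) adj_commute
      unfolding nbrs_def N_def Q_def nonnbrs_def triangle_free_def by blast
    moreover have "v \<notin> {q \<in> Q. w \<sim> q}" unfolding Q_def nonnbrs_def by auto
    moreover have "card (nbrs V w) = 3" using w assms(3) nbrs_subset unfolding N_def by auto
    ultimately show ?thesis using fin by auto
  qed
  moreover have "card N = 3" using assms(3,4) unfolding N_def by auto
  ultimately show False using Q3(3) by simp
qed

text \<open>In a counterexample whose vertex-deleted subgraphs are 3-colourable, degrees are at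
  least three and no non-neighbourhood is 2-colourable. Hence each non-neighbourhood has no
  independent triple and exactly five vertices, and all degrees equal three, which
  \<open>no_cubic_nine\<close> excludes.\<close>

lemma colorable_triangle_free_P3_2K1_free:
  assumes "finite V" "triangle_free V" "P3_2K1_free V"
  shows "colorable 3 V"
  using assms
proof (induction "card V" arbitrary: V)
  case 0
  then show ?case by (simp add: colorable_empty)
next
  case (Suc n)
  note fin = Suc.prems(1) and tri = Suc.prems(2) and P = Suc.prems(3)
  \<comment> \<open>The independent neighbourhood of \<open>v\<close> is the third colour
    class.\<close>
  have via: "colorable 3 V" if "v \<in> V" "colorable 2 (nonnbrs V v)" for v
    using colorable_Suc[OF colorable_insert_nonnbrs[OF that(2) fin] independent_nbrs[OF tri that(1)] vertices_split]
    by (simp add: numeral_3_eq_3 numeral_2_eq_2)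
  have tri': "triangle_free (nonnbrs V v)" for v
    using tri nonnbrs_subset triangle_free_mono by blast
  show ?case
  proof (rule ccontr)
    assume not: "\<not> colorable 3 V"
    have ge3: "3 \<le> card (nbrs V v)" if v: "v \<in> V" for v
    proof (rule ccontr)
      assume "\<not> 3 \<le> card (nbrs V v)"
      moreover have "colorable 3 (V - {v})"
        by (rule Suc.hyps(1)) (use Suc v in \<open>auto intro: triangle_free_mono P3_2K1_free_mono\<close>)
      ultimately show False using not colorable_greedy[OF fin, of 3 v] by linarith
    qed
    have no_triple: "no_indep_triple (nonnbrs V v)" if v: "v \<in> V" for v
      using colorable_triangle_free_indep_triple[of "nonnbrs V v"] via[OF v] not tri' P v fin finite_nonnbrs
      unfolding P3_2K1_free_def by blast
    have card5: "card (nonnbrs V v) = 5" if v: "v \<in> V" for v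
    proof -
      have "card (nonnbrs V v) \<le> 5"
        using card_le_5 no_triple[OF v] tri' fin finite_nonnbrs by blast
      moreover have "\<not> card (nonnbrs V v) \<le> 4"
        using colorable_triangle_free_card_le_4[of "nonnbrs V v"] via[OF v] not tri' fin finite_nonnbrs by blast
      ultimately show ?thesis by linarith
    qed
    have "card (nbrs V v) = 3" if v: "v \<in> V" for v
    proof -
      have "card (nbrs V v) \<le> 3"
      proof (rule card_le_3I)
        \<comment> \<open>Four neighbours are pairwise non-adjacent, so three of them form an
          independent triple among the non-neighbours of the fourth.\<close>
        fix w x y z assume "{w, x, y, z} \<subseteq> nbrs V v" "distinct [w, x, y, z]"
        moreover from this have "\<not> w \<sim> x" "\<not> w \<sim> y" "\<not> w \<sim> z" "\<not> x \<sim> y" "\<not> x \<sim> z" "\<not> y \<sim> z"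
          using independent_nbrs[OF tri v] unfolding independent_def by auto
        ultimately show False
          using no_triple[of w] unfolding no_indep_triple_def nonnbrs_def nbrs_def by auto
      qed (use fin finite_nbrs in auto)
      then show ?thesis using ge3[OF v] by linarith
    qed
    moreover obtain v where "v \<in> V" using Suc.hyps(2) by fastforce
    ultimately show False
      using no_cubic_nine[of V v] fin tri card5 no_triple by blast
  qed
qed

section \<open>K4-free graphs without an independent triple\<close>

lemma card_nonnbrs_le_3:
  assumes "finite V" "K4_free V" "no_indep_triple V" "v \<in> V"
  shows "card (nonnbrs V v) \<le> 3"
proof (rule card_le_3I)
  fix w x y z assume *: "{w, x, y, z} \<subseteq> nonnbrs V v" "distinct [w, x, y, z]"
  then have "w \<sim> x" "w \<sim> y" "w \<sim> z" "x \<sim> y" "x \<sim> z" "y \<sim> z"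
    using nonnbrs_adj[OF assms(3,4)] by auto
  moreover have "{w, x, y, z} \<subseteq> V" using * nonnbrs_subset by blast
  ultimately show False using assms(2) unfolding K4_free_def triangle_free_def nbrs_def by (simp, blast)
qed (use assms finite_nonnbrs in auto)

lemma complement_graph: "simple_graph (\<lambda>x y. x \<noteq> y \<and> \<not> x \<sim> y)"
  by unfold_locales (auto dest: adj_sym)

text \<open>This is \<open>no_cubic_nine\<close> in the complement, where \<open>nbrs\<close> and
  \<open>nonnbrs\<close> trade places and independent triples become triangles.\<close>

lemma no_codegree_3_nine:
  assumes "finite V" "no_indep_triple V" "\<And>x. x \<in> V \<Longrightarrow> card (nonnbrs V x) = 3" "v \<in> V"
    and "card (nbrs V v) = 5" "triangle_free (nbrs V v)"
  shows False
proof -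
  interpret co: simple_graph "\<lambda>x y. x \<noteq> y \<and> \<not> x \<sim> y" by (rule complement_graph)
  have nbrs: "co.nbrs V x = nonnbrs V x" for x
    unfolding co.nbrs_def nonnbrs_def by auto
  have nonnbrs: "co.nonnbrs V x = nbrs V x" for x
    unfolding co.nonnbrs_def nbrs_def using adj_irrefl by auto
  have "co.triangle_free V"
    using assms(2) unfolding co.triangle_free_def no_indep_triple_def by metis
  moreover have "co.no_indep_triple (nbrs V v)"
    using assms(6) unfolding co.no_indep_triple_def triangle_free_def by metis
  ultimately show False
    using co.no_cubic_nine[of V v] assms by (simp add: nbrs nonnbrs)
qed

text \<open>
  Inside the four neighbours of \<open>u\<close> the non-edges form a path \<open>y - b - z - w\<close>, because exactly
  six non-edges leave towards the three non-neighbours of \<open>u\<close>. The ends \<open>y\<close> and \<open>w\<close> each have two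
  non-neighbours there, which leaves room for four disjoint non-edges covering all eight vertices.
\<close>
lemma colorable_codegree_3_eight:
  assumes fin: "finite V" and alpha: "no_indep_triple V" and co3: "\<And>x. x \<in> V \<Longrightarrow> card (nonnbrs V x) = 3"
    and u: "u \<in> V" "card (nbrs V u) = 4" "triangle_free (nbrs V u)"
  shows "colorable 4 V"
proof -
  define N where "N = nbrs V u"
  define T where "T = nonnbrs V u"
  have finNT: "finite N" "finite T" using fin finite_nbrs finite_nonnbrs unfolding N_def T_def by auto
  have NV: "N \<subseteq> V" and TV: "T \<subseteq> V" using nbrs_subset nonnbrs_subset unfolding N_def T_def by auto
  have tri: "triangle_free N" and alphaN: "no_indep_triple N" and cardN: "card N = 4"
    using u(2,3) no_indep_triple_mono[OF alpha NV] unfolding N_def by auto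
  have cardT: "card T = 3" using co3[OF u(1)] unfolding T_def by simp
  \<comment> \<open>The three non-neighbours of a vertex of \<open>N\<close> are split into
    \<open>h\<close> many inside \<open>N\<close> and \<open>\<tau>\<close> many inside
    \<open>T\<close>.\<close>
  define h where "h x = card (nonnbrs N x)" for x
  define \<tau> where "\<tau> x = card {t \<in> T. \<not> x \<sim> t}" for x
  have h\<tau>: "h x + \<tau> x = 3" if x: "x \<in> N" for x
  proof -
    have "nonnbrs V x = nonnbrs N x \<union> {t \<in> T. \<not> x \<sim> t}"
      using x adj_commute unfolding nonnbrs_def N_def T_def nbrs_def by auto
    moreover have "nonnbrs N x \<inter> {t \<in> T. \<not> x \<sim> t} = {}"
      unfolding nonnbrs_def N_def T_def nbrs_def by auto
    ultimately have "card (nonnbrs V x) = h x + \<tau> x"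
      unfolding h_def \<tau>_def using finNT finite_nonnbrs by (simp add: card_Un_disjoint)
    then show ?thesis using co3 x NV by auto
  qed
  have h_le: "h x \<le> 2" if "x \<in> N" for x
    unfolding h_def using card_nonnbrs_le_2[OF finNT(1) tri alphaN that] .
  \<comment> \<open>As \<open>T\<close> is a clique, the three non-neighbours of \<open>t\<close>
    are \<open>u\<close> and two vertices of \<open>N\<close>.\<close>
  have "card {x \<in> N. \<not> x \<sim> t} = 2" if t: "t \<in> T" for t
  proof -
    have "nonnbrs V t = insert u {x \<in> N. \<not> x \<sim> t}"
    proof (intro set_eqI iffI)
      fix x assume x: "x \<in> nonnbrs V t"
      show "x \<in> insert u {x \<in> N. \<not> x \<sim> t}"
      proof (cases "x \<in> T")
        case True
        then show ?thesis using nonnbrs_adj[OF alpha u(1), of t x] x t unfolding nonnbrs_def T_def by auto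
      next
        case False
        then show ?thesis using x adj_commute unfolding nonnbrs_def T_def N_def nbrs_def by auto
      qed
    next
      fix x assume "x \<in> insert u {x \<in> N. \<not> x \<sim> t}"
      then show "x \<in> nonnbrs V t"
        using t u(1) adj_commute unfolding nonnbrs_def T_def N_def nbrs_def by auto
    qed
    moreover have "u \<notin> {x \<in> N. \<not> x \<sim> t}" using adj_irrefl unfolding N_def nbrs_def by auto
    moreover have "card (nonnbrs V t) = 3" using t TV co3 by auto
    ultimately show ?thesis using finNT by auto
  qed
  then have "(\<Sum>x\<in>N. \<tau> x) = 2 * card T"
    unfolding \<tau>_def by (intro sum_multicount finNT) auto
  moreover have "(\<Sum>x\<in>N. h x) + (\<Sum>x\<in>N. \<tau> x) = (\<Sum>x\<in>N. 3)"
    unfolding sum.distrib[symmetric] using h\<tau> by (intro sum.cong) auto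
  ultimately have sum_h: "(\<Sum>x\<in>N. h x) = 6" using cardT cardN by simp
  \<comment> \<open>The values of \<open>h\<close> average 3/2 and are at most 2.\<close>
  have "\<exists>b\<in>N. h b = 2"
  proof (rule ccontr)
    assume "\<not> ?thesis"
    then have "h x \<le> 1" if "x \<in> N" for x using h_le[OF that] that by (metis One_nat_def Suc_1 le_SucE)
    then have "(\<Sum>x\<in>N. h x) \<le> (\<Sum>x\<in>N. 1)" by (intro sum_mono) auto
    then show False using sum_h cardN by simp
  qed
  then obtain b where b: "b \<in> N" "h b = 2" by blast
  have "card (nbrs N b) = 1" using card_split[OF finNT(1) b(1)] b cardN unfolding h_def by simp
  then obtain w where w: "nbrs N b = {w}" by (auto simp: card_1_singleton_iff)
  \<comment> \<open>Kept general in \<open>y\<close> and \<open>z\<close>: \<open>w\<close> misses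
    at least one of these adjacent vertices, and that one is taken as \<open>z\<close>.\<close>
  have covered: "colorable 4 V"
    if yz: "nonnbrs N b = {y, z}" "y \<noteq> z" and wz: "\<not> w \<sim> z" for y z
  proof -
    have N: "N = {b, w, y, z}" using w yz(1) b(1) unfolding nbrs_def nonnbrs_def by auto
    have dist: "distinct [b, w, y, z]"
      using cardN unfolding N by (intro card_distinct) auto
    have bw: "b \<sim> w" and nby: "\<not> b \<sim> y" and bz: "\<not> b \<sim> z"
      using w yz unfolding nbrs_def nonnbrs_def by auto
    have yz': "y \<sim> z" using nonnbrs_adj[OF alphaN b(1)] yz by auto
    have "nonnbrs N z = {b, w}"
      using dist bz wz yz' adj_commute by (auto simp: N nonnbrs_def)
    then have hz: "h z = 2" unfolding h_def using dist by simp
    have "h b + h w + h y + h z = 6" using sum_h dist unfolding N by simp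
    then have hwy: "h w + h y = 2" using b hz by simp
    \<comment> \<open>Otherwise \<open>h w\<close> and \<open>h y\<close> would both be 2, although
      they sum to 2.\<close>
    have wy: "w \<sim> y"
    proof (rule ccontr)
      assume "\<not> w \<sim> y"
      then have "nonnbrs N w = {y, z}" "nonnbrs N y = {b, w}"
        using dist bw nby wz yz' adj_commute by (auto simp: N nonnbrs_def)
      then show False using hwy dist unfolding h_def by simp
    qed
    have "nonnbrs N w = {z}" "nonnbrs N y = {b}"
      using dist bw nby wz wy yz' adj_commute by (auto simp: N nonnbrs_def)
    then have "h w = 1" "h y = 1" unfolding h_def by auto
    then have "\<tau> w = 2" "\<tau> y = 2" using h\<tau>[of w] h\<tau>[of y] N by auto
    then obtain s where s: "s \<in> T" "\<not> y \<sim> s"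
      unfolding \<tau>_def by (metis (mono_tags, lifting) card.empty empty_Collect_eq zero_neq_numeral)
    have "\<exists>t\<in>T. \<not> w \<sim> t \<and> t \<noteq> s"
    proof (rule ccontr)
      assume "\<not> ?thesis"
      then have "{t \<in> T. \<not> w \<sim> t} \<subseteq> {s}" by auto
      then have "\<tau> w \<le> card {s}" unfolding \<tau>_def by (intro card_mono) auto
      then show False using \<open>\<tau> w = 2\<close> by simp
    qed
    then obtain t where t: "t \<in> T" "\<not> w \<sim> t" "t \<noteq> s" by blast
    have "card (T - {s, t}) = 1" using cardT s t finNT by (simp add: card_Diff_subset)
    then obtain r where r: "T - {s, t} = {r}" by (auto simp: card_1_singleton_iff)
    have T: "T \<subseteq> {r, s, t}" using r by auto
    have "\<not> u \<sim> r" using r unfolding T_def nonnbrs_def by auto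
    have "V \<subseteq> insert u (T \<union> N)" using vertices_split[of V u] unfolding T_def N_def by auto
    also have "\<dots> \<subseteq> {u, r, w, t, y, s} \<union> {b, z}" using T unfolding N by auto
    finally have V: "V \<subseteq> {u, r, w, t, y, s} \<union> {b, z}" .
    \<comment> \<open>The colour classes are the non-edges \<open>{u, r}\<close>,
      \<open>{w, t}\<close>, \<open>{y, s}\<close> and \<open>{b, z}\<close>.\<close>
    have "colorable 1 {u, r}"
      by (intro colorable_independent independent_pair) fact
    then have "colorable (Suc 1) {u, r, w, t}"
      by (rule colorable_Suc[OF _ independent_pair[OF t(2)]]) auto
    then have "colorable (Suc (Suc 1)) {u, r, w, t, y, s}"
      by (rule colorable_Suc[OF _ independent_pair[OF s(2)]]) auto
    from colorable_Suc[OF this independent_pair[OF bz] V] show ?thesis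
      by (simp add: eval_nat_numeral)
  qed
  obtain y z where yz: "nonnbrs N b = {y, z}" "y \<noteq> z" using b(2) unfolding h_def card_2_iff by blast
  have "y \<sim> z" using nonnbrs_adj[OF alphaN b(1)] yz by auto
  moreover have "{w, y, z} \<subseteq> N" using w yz unfolding nbrs_def nonnbrs_def by blast
  ultimately have "\<not> w \<sim> y \<or> \<not> w \<sim> z" using tri unfolding triangle_free_def by auto
  then show ?thesis using covered[of y z] covered[of z y] yz by (auto simp: insert_commute)
qed

text \<open>In a counterexample whose vertex-deleted subgraphs are 4-colourable, degrees are 4 or 5
  and every vertex has exactly three non-neighbours. The two preceding results then treat nine and
  eight vertices.\<close>

lemma colorable_K4_free_no_indep_triple:
  assumes "finite V" "K4_free V" "no_indep_triple V"
  shows "colorable 4 V"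
  using assms
proof (induction "card V" arbitrary: V)
  case 0
  then show ?case by (simp add: colorable_empty)
next
  case (Suc n)
  note fin = Suc.prems(1) and K4 = Suc.prems(2) and alpha = Suc.prems(3)
  have triN: "triangle_free (nbrs V v)" and alphaN: "no_indep_triple (nbrs V v)" if "v \<in> V" for v
    using K4 that no_indep_triple_mono[OF alpha nbrs_subset] unfolding K4_free_def by auto
  show ?case
  proof (rule ccontr)
    assume not: "\<not> colorable 4 V"
    have ge4: "4 \<le> card (nbrs V v)" if v: "v \<in> V" for v
    proof (rule ccontr)
      assume "\<not> 4 \<le> card (nbrs V v)"
      moreover have "colorable 4 (V - {v})"
        by (rule Suc.hyps(1)) (use Suc v in \<open>auto intro: K4_free_mono no_indep_triple_mono\<close>)
      ultimately show False using not colorable_greedy[OF fin, of 4 v] by linarith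
    qed
    have le5: "card (nbrs V v) \<le> 5" if v: "v \<in> V" for v
      using card_le_5[OF finite_nbrs[OF fin] triN[OF v] alphaN[OF v]] .
    \<comment> \<open>With at most one non-neighbour, \<open>v\<close> shares a colour with it and
      the neighbourhood takes three more.\<close>
    have co_ge2: "2 \<le> card (nonnbrs V v)" if v: "v \<in> V" for v
    proof (rule ccontr)
      assume "\<not> 2 \<le> card (nonnbrs V v)"
      then have "independent (nonnbrs V v)"
        using card_le_Suc0_iff_eq[OF finite_nonnbrs[OF fin], of v] adj_irrefl
        by (auto simp: independent_def)
      then have "colorable 1 (insert v (nonnbrs V v))"
        by (intro colorable_insert_nonnbrs colorable_independent fin) auto
      from colorable_Un[OF this colorable_triangle_free_no_indep_triple[OF finite_nbrs[OF fin] triN[OF v] alphaN[OF v]]]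
      have "colorable 4 V" by (rule colorable_mono[OF _ vertices_split]) simp
      then show False using not by blast
    qed
    have co3: "card (nonnbrs V v) = 3" if v: "v \<in> V" for v
    proof (rule ccontr)
      assume "card (nonnbrs V v) \<noteq> 3"
      then have "card (nonnbrs V v) = 2"
        using co_ge2[OF v] card_nonnbrs_le_3[OF fin K4 alpha v] by linarith
      then obtain s t where st: "nonnbrs V v = {s, t}" "s \<noteq> t" by (meson card_2_iff)
      then have sV: "s \<in> V" "\<not> v \<sim> s" "\<not> v \<sim> t" "s \<noteq> v" unfolding nonnbrs_def by auto
      have "s \<sim> t" using nonnbrs_adj[OF alpha v] st by auto
      \<comment> \<open>A second non-neighbour \<open>p\<close> of \<open>s\<close> lies in
        \<open>nbrs V v\<close>. The classes \<open>{s, p}\<close> and \<open>{v, t}\<close> leave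
        at most four neighbours of \<open>v\<close>, for which two colours suffice.\<close>
      have "\<exists>p \<in> nonnbrs V s. p \<noteq> v"
      proof (rule ccontr)
        assume "\<not> ?thesis"
        then have "nonnbrs V s \<subseteq> {v}" by auto
        then have "card (nonnbrs V s) \<le> card {v}" by (intro card_mono) auto
        then show False using co_ge2[OF sV(1)] by simp
      qed
      then obtain p where p: "p \<in> V" "p \<noteq> s" "\<not> s \<sim> p" "p \<noteq> v" unfolding nonnbrs_def by auto
      then have pN: "p \<in> nbrs V v"
        using st \<open>s \<sim> t\<close> unfolding nonnbrs_def nbrs_def by blast
      have "card (nbrs V v - {p}) \<le> 4" using le5[OF v] pN finite_nbrs[OF fin] by simp
      then have "colorable 2 (nbrs V v - {p})"
        by (intro colorable_triangle_free_card_le_4 triangle_free_mono[OF triN[OF v]])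
          (auto simp: finite_nbrs fin)
      then have "colorable (Suc 2) ((nbrs V v - {p}) \<union> {s, p})"
        by (rule colorable_Suc[OF _ independent_pair[OF p(3)]]) auto
      then have "colorable (Suc (Suc 2)) V"
        by (rule colorable_Suc[OF _ independent_pair[OF sV(3)]])
          (use vertices_split[of V v] st in auto)
      then show False using not by simp
    qed
    obtain v where v: "v \<in> V" using Suc.hyps(2) by fastforce
    have "card (nbrs V v) = 4 \<or> card (nbrs V v) = 5" using ge4[OF v] le5[OF v] by linarith
    then show False
      using no_codegree_3_nine[OF fin alpha co3 v] colorable_codegree_3_eight[OF fin alpha co3 v]
        triN[OF v] not by blast
  qed
qed

section \<open>K4-free graphs with forbidden P3 + K1 or P3 + 2K1\<close>

text \<open>In the join of nonempty \<open>A\<close> with \<open>U\<close>, each side lies in a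
  neighbourhood and is triangle-free, and edges on both sides would give a K4. So one side is
  independent: 3 + 1 colours suffice if it is \<open>U\<close>, and 2 + 1 if it is
  \<open>A\<close>.\<close>

lemma colorable_K4_free_P3_K1_free:
  assumes "finite V" "K4_free V" "P3_K1_free V"
  shows "colorable 4 V"
proof (cases "no_indep_triple V")
  case True
  then show ?thesis using colorable_K4_free_no_indep_triple assms by blast
next
  case False
  obtain A U where AU: "V = A \<union> U" "U \<noteq> {}" "P3_free U" "\<And>a u. a \<in> A \<Longrightarrow> u \<in> U \<Longrightarrow> a \<sim> u"
    using P3_K1_free_decomposition[OF assms(3) False] by metis
  have finAU: "finite A" "finite U" using AU(1) assms(1) by auto
  have UA: "u \<sim> a" if "a \<in> A" "u \<in> U" for a u using AU(4) that adj_sym by blast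
  consider "A = {}" | "independent U" | x y a where "a \<in> A" "x \<in> U" "y \<in> U" "x \<sim> y"
    unfolding independent_def by blast
  then show ?thesis
  proof cases
    case 1
    then have "colorable 3 V" using colorable_P3_free_K4_free assms AU by auto
    then show ?thesis by (rule colorable_mono) auto
  next
    case 2
    obtain u where u: "u \<in> U" using AU(2) by blast
    then have "A \<subseteq> nbrs V u" using UA AU(1) unfolding nbrs_def by auto
    then have "triangle_free A"
      using assms(2) u AU(1) triangle_free_mono unfolding K4_free_def by blast
    then have "colorable 3 A"
      using colorable_triangle_free_P3_K1_free finAU P3_K1_free_mono[OF assms(3)] AU(1) by blast
    from colorable_Suc[OF this 2, of V] show ?thesis using AU(1) by simp
  next
    case 3
    have "independent A"
      unfolding independent_def
    proof (intro ballI notI)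
      fix c d assume cd: "c \<in> A" "d \<in> A" "c \<sim> d"
      then have "y \<in> nbrs V x" "c \<in> nbrs V x" "d \<in> nbrs V x" "x \<in> V"
        using UA 3 AU(1) unfolding nbrs_def by auto
      moreover have "y \<sim> c" "y \<sim> d" using UA 3 cd by auto
      ultimately show False using assms(2) cd(3) unfolding K4_free_def triangle_free_def by blast
    qed
    have "U \<subseteq> nbrs V a" "a \<in> V" using 3 AU unfolding nbrs_def by auto
    then have "triangle_free U" using assms(2) triangle_free_mono unfolding K4_free_def by blast
    then have "colorable 2 U" using colorable_P3_free_triangle_free finAU AU(3) by blast
    then have "colorable (Suc 2) V"
      using colorable_Suc[OF _ \<open>independent A\<close>, of 2 U V] AU(1) by blast
    then show ?thesis by (rule colorable_mono) auto
  qed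
qed

lemma colorable_K4_free_P3_2K1_free:
  assumes "finite V" "K4_free V" "P3_2K1_free V"
  shows "colorable 7 V"
proof (cases "V = {}")
  case True
  then show ?thesis by (simp add: colorable_empty)
next
  case False
  then obtain v where v: "v \<in> V" by blast
  have "colorable 4 (nonnbrs V v)"
    using assms v K4_free_mono[OF assms(2) nonnbrs_subset] finite_nonnbrs
    by (intro colorable_K4_free_P3_K1_free) (auto simp: P3_2K1_free_def)
  then have "colorable 4 (insert v (nonnbrs V v))"
    using colorable_insert_nonnbrs assms(1) by simp
  moreover have "colorable 3 (nbrs V v)"
    using assms v P3_2K1_free_mono[OF assms(3) nbrs_subset] finite_nbrs
    by (intro colorable_triangle_free_P3_2K1_free) (auto simp: K4_free_def)
  ultimately have "colorable (4 + 3) (insert v (nonnbrs V v) \<union> nbrs V v)"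
    by (rule colorable_Un)
  then show ?thesis by (rule colorable_mono[OF _ vertices_split]) simp
qed

end

section \<open>Transfer from digraphs to adjacency relations\<close>

text \<open>A digraph isomorphism also needs a map on arcs; without parallel arcs, the vertex
  bijection determines it.\<close>

lemma has_induced_copyI:
  assumes G: "graph G" and S: "S \<subseteq> verts G" and f: "bij_betw f S (pverts H)"
    and H: "parcs H \<subseteq> pverts H \<times> pverts H"
    and arcs: "\<And>u v. u \<in> S \<Longrightarrow> v \<in> S \<Longrightarrow> u \<rightarrow>\<^bsub>G\<^esub> v \<longleftrightarrow> (f u, f v) \<in> parcs H"
  shows "has_induced_copy G (with_proj H)"
proof -
  interpret graph G by (rule G)
  define K where "K = \<lparr>verts = S, arcs = {e \<in> arcs G. tail G e \<in> S \<and> head G e \<in> S},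
    tail = tail G, head = head G\<rparr>"
  \<comment> \<open>Arcs of \<open>with_proj H\<close> are vertex pairs with ends \<open>fst\<close>
    and \<open>snd\<close>, so an arc goes to the pair of images of its ends.\<close>
  define hom where "hom = \<lparr>iso_verts = f, iso_arcs = \<lambda>e. (f (tail G e), f (head G e)),
    iso_head = snd, iso_tail = fst\<rparr>"
  have inj: "inj_on f S" and img: "f ` S = pverts H" using f by (auto simp: bij_betw_def)
  have "wf_digraph K" by unfold_locales (auto simp: K_def)
  then have "induced_subgraph K G"
    using S wf_digraph by (auto simp: induced_subgraph_def subgraph_def compatible_def K_def)
  moreover have "pre_digraph.digraph_isomorphism K hom"
    unfolding pre_digraph.digraph_isomorphism_def
  proof (intro conjI)
    show "inj_on (iso_arcs hom) (arcs K)"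
    proof (rule inj_onI)
      fix d e assume "d \<in> arcs K" "e \<in> arcs K" "iso_arcs hom d = iso_arcs hom e"
      then have "d \<in> arcs G" "e \<in> arcs G" "arc_to_ends G d = arc_to_ends G e"
        using inj by (auto simp: K_def hom_def arc_to_ends_def dest: inj_onD)
      then show "d = e" by (rule no_multi_arcs)
    qed
  qed (use \<open>wf_digraph K\<close> inj in \<open>auto simp: K_def hom_def\<close>)
  moreover have "(\<lambda>e. (f (tail G e), f (head G e))) ` arcs K = parcs H"
  proof (intro equalityI subsetI)
    fix p assume "p \<in> (\<lambda>e. (f (tail G e), f (head G e))) ` arcs K"
    then show "p \<in> parcs H" using arcs by (auto simp: K_def arcs_ends_conv)
  next
    fix p assume p: "p \<in> parcs H"
    then obtain u v where uv: "u \<in> S" "v \<in> S" "p = (f u, f v)" using H img by blast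
    then have "u \<rightarrow>\<^bsub>G\<^esub> v" using arcs p by blast
    then obtain e where "e \<in> arcs G" "tail G e = u" "head G e = v" by blast
    then show "p \<in> (\<lambda>e. (f (tail G e), f (head G e))) ` arcs K"
      using uv by (auto simp: K_def intro!: rev_image_eqI[of e])
  qed
  then have "with_proj H = app_iso hom K"
    using img by (simp add: app_iso_def with_proj_def hom_def) (simp add: K_def)
  ultimately show ?thesis unfolding has_induced_copy_def digraph_iso_def by blast
qed

lemma simple_graph_adjacency:
  assumes "graph G"
  shows "simple_graph (\<lambda>u v. u \<rightarrow>\<^bsub>G\<^esub> v)"
proof -
  interpret graph G by (rule assms)
  show ?thesis
    by unfold_locales (auto intro: arcs_ends_symmetric sym_arcs dest: adj_not_same)
qed

lemma P3_2K1_free_verts: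
  assumes G: "graph G" and no_copy: "\<not> has_induced_copy G (with_proj P3_2K1)"
  shows "simple_graph.P3_2K1_free (\<lambda>u v. u \<rightarrow>\<^bsub>G\<^esub> v) (verts G)"
proof -
  interpret simple_graph "\<lambda>u v. u \<rightarrow>\<^bsub>G\<^esub> v" using G by (rule simple_graph_adjacency)
  show ?thesis
    unfolding P3_2K1_free_def P3_K1_free_def P3_free_def
  proof (intro ballI impI, rule ccontr)
    fix v w x y z
    assume "v \<in> verts G" "w \<in> nonnbrs (verts G) v" "x \<in> nonnbrs (nonnbrs (verts G) v) w"
      "y \<in> nonnbrs (nonnbrs (verts G) v) w" "z \<in> nonnbrs (nonnbrs (verts G) v) w"
      and path: "x \<noteq> z" "x \<rightarrow>\<^bsub>G\<^esub> y" "y \<rightarrow>\<^bsub>G\<^esub> z" "\<not> x \<rightarrow>\<^bsub>G\<^esub> z"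
    then have S: "{x, y, z, w, v} \<subseteq> verts G" and ne: "distinct [x, y, z, w, v]"
      and nonadj: "\<not> w \<rightarrow>\<^bsub>G\<^esub> x" "\<not> w \<rightarrow>\<^bsub>G\<^esub> y" "\<not> w \<rightarrow>\<^bsub>G\<^esub> z" "\<not> v \<rightarrow>\<^bsub>G\<^esub> x" "\<not> v \<rightarrow>\<^bsub>G\<^esub> y" "\<not> v \<rightarrow>\<^bsub>G\<^esub> z" "\<not> v \<rightarrow>\<^bsub>G\<^esub> w"
      using adj_irrefl by (auto simp: nonnbrs_def)
    have adj: "y \<rightarrow>\<^bsub>G\<^esub> x" "z \<rightarrow>\<^bsub>G\<^esub> y" "\<not> z \<rightarrow>\<^bsub>G\<^esub> x" "\<not> x \<rightarrow>\<^bsub>G\<^esub> w" "\<not> y \<rightarrow>\<^bsub>G\<^esub> w" "\<not> z \<rightarrow>\<^bsub>G\<^esub> w"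
      "\<not> x \<rightarrow>\<^bsub>G\<^esub> v" "\<not> y \<rightarrow>\<^bsub>G\<^esub> v" "\<not> z \<rightarrow>\<^bsub>G\<^esub> v" "\<not> w \<rightarrow>\<^bsub>G\<^esub> v"
      using path nonadj adj_sym by blast+
    \<comment> \<open>The numbering of \<open>P3_2K1\<close>: the path \<open>x\<close>,
      \<open>y\<close>, \<open>z\<close> becomes 0, 1, 2, and the isolated \<open>w\<close> and
      \<open>v\<close> become 3 and 4.\<close>
    define f :: "'a \<Rightarrow> nat" where
      "f a = (if a = x then 0 else if a = y then 1 else if a = z then 2 else if a = w then 3 else 4)" for a
    have f: "f x = 0" "f y = 1" "f z = 2" "f w = 3" "f v = 4" using ne by (auto simp: f_def)
    have "has_induced_copy G (with_proj P3_2K1)"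
    proof (rule has_induced_copyI[OF G S])
      show "bij_betw f {x, y, z, w, v} (pverts P3_2K1)"
        by (auto simp: bij_betw_def f P3_2K1_def)
      show "parcs P3_2K1 \<subseteq> pverts P3_2K1 \<times> pverts P3_2K1" by (auto simp: P3_2K1_def)
      fix a b assume "a \<in> {x, y, z, w, v}" "b \<in> {x, y, z, w, v}"
      then show "a \<rightarrow>\<^bsub>G\<^esub> b \<longleftrightarrow> (f a, f b) \<in> parcs P3_2K1"
        by (elim insertE emptyE) (simp_all add: f P3_2K1_def path nonadj adj adj_irrefl)
    qed
    then show False using no_copy by blast
  qed
qed

lemma card_clique_le_clique_number:
  assumes "graph G" "is_clique G S"
  shows "card S \<le> clique_number G"
proof -
  interpret graph G by (rule assms)
  have "{S. is_clique G S} \<subseteq> Pow (verts G)" by (auto simp: is_clique_def)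
  then have "finite {S. is_clique G S}" by (rule finite_subset) simp
  then show ?thesis unfolding clique_number_def using assms(2) by (intro Max_ge) auto
qed

lemma K4_free_verts:
  assumes G: "graph G" and "clique_number G \<le> 3"
  shows "simple_graph.K4_free (\<lambda>u v. u \<rightarrow>\<^bsub>G\<^esub> v) (verts G)"
proof -
  interpret simple_graph "\<lambda>u v. u \<rightarrow>\<^bsub>G\<^esub> v" using G by (rule simple_graph_adjacency)
  show ?thesis
    unfolding K4_free_def triangle_free_def
  proof (intro ballI notI)
    fix w x y z
    assume "w \<in> verts G" "x \<in> nbrs (verts G) w" "y \<in> nbrs (verts G) w" "z \<in> nbrs (verts G) w"
      and xyz: "x \<rightarrow>\<^bsub>G\<^esub> y \<and> x \<rightarrow>\<^bsub>G\<^esub> z \<and> y \<rightarrow>\<^bsub>G\<^esub> z"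
    then have V: "{w, x, y, z} \<subseteq> verts G" and w: "w \<rightarrow>\<^bsub>G\<^esub> x" "w \<rightarrow>\<^bsub>G\<^esub> y" "w \<rightarrow>\<^bsub>G\<^esub> z"
      by (auto simp: nbrs_def)
    then have "is_clique G {w, x, y, z}"
      using xyz adj_sym unfolding is_clique_def pairwise_def by auto
    moreover have "distinct [w, x, y, z]" using w xyz adj_irrefl by auto
    then have "card {w, x, y, z} = 4" by simp
    ultimately show False
      using card_clique_le_clique_number[OF G, of "{w, x, y, z}"] assms(2) by simp
  qed
qed

theorem theorem3p11:
  fixes G :: "('a, 'b) pre_digraph"
  assumes "graph G"
    and "\<not> has_induced_copy G (with_proj P3_2K1)"
    and "\<not> has_induced_copy G (with_proj (graph_complement P3_2K1))"
    and "clique_number G = 3"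
  shows "chromatic_number G \<le> 7"
proof -
  interpret graph G by (rule assms)
  interpret S: simple_graph "\<lambda>u v. u \<rightarrow>\<^bsub>G\<^esub> v" using assms(1) by (rule simple_graph_adjacency)
  have "S.colorable 7 (verts G)"
    using K4_free_verts P3_2K1_free_verts assms by (intro S.colorable_K4_free_P3_2K1_free) auto
  then have "\<exists>c. is_coloring G 7 c"
    unfolding S.colorable_def is_coloring_def using adj_in_verts by blast
  then show ?thesis unfolding chromatic_number_def by (rule Least_le)
qed

end
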